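(* Let $\langle S,Gr(S),T,Gr_*,Gr_b^*\rangle$ be a bitten approximation system with $Gr(S)$ finite, and consider the AUAI approximation system $\langle S,Gr(S)\rangle$, that is, the one obtained by taking $\mathcal{K}=Gr(S)$. Then \begin{enumerate} \item for all $X\in\wp(S)$, $X^{l1}=Gr_*(X)$; \item for all $X\in\wp(S)$, $X^{u1}\subseteq Gr^*(X)$; \item for all $X\in\wp(S)$, $Gr_b^*(X)=Gr^*(X)\cap X^{u2}$. \end{enumerate}
   Context: A bitten approximation system $\langle S,Gr(S),T,Gr_*,Gr_b^*\rangle$ consists of a set $S$ with a tolerance (reflexive and symmetric) relation $T$, a collection $Gr(S)\subseteq\wp(S)$ of granules (associated with $T$; nothing more is required than $\bigcup Gr(S)=S$), and the operators on $\wp(S)$ given, with $X^c=S\setminus X$, by $$Gr_*(X)=\bigcup\{A\in Gr(S): A\subseteq X\},\qquad Gr^*(X)=\bigcup\{A\in Gr(S): A\cap X\neq\emptyset\},$$ $$Gr_b^*(X)=Gr^*(X)\setminus Gr_*(X^c).$$ An AUAI approximation system $\langle S,\mathcal{K}\rangle$ consists of a set $S$ and a finite collection $\mathcal{K}=\{K_1,\dots,K_n\}$ of subsets of $S$. Put $K_0=\emptyset$ and $K_{n+1}=S$. For $X\subseteq S$ define $$X^{l1}=\bigcup\{K_i: K_i\subseteq X,\ i\in\{0,1,\dots,n\}\},$$ $$X^{u1}=\bigcap\Big\{\bigcup_{i\in I}K_i:\ X\subseteq\bigcup_{i\in I}K_i,\ I\subseteq\{1,\dots,n+1\}\Big\},$$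 $$X^{u2}=\bigcap\{S\setminus K_i:\ X\subseteq S\setminus K_i,\ i\in\{0,\dots,n\}\}.$$ *)

theory Defs
  imports Main
begin

text \<open>
  The two operators of a bitten approximation system are determined by \<open>S\<close> and the granulation
  \<open>G\<close>, so the system is given by \<open>S\<close>, \<open>T\<close> and \<open>G\<close>. The tolerance and the granules are not
  linked beyond the covering condition.
\<close>

definition bitten_approximation_system ::
    "'a set \<Rightarrow> ('a \<times> 'a) set \<Rightarrow> 'a set set \<Rightarrow> bool" where
  "bitten_approximation_system S T G \<longleftrightarrow>
     T \<subseteq> S \<times> S \<and> refl_on S T \<and> sym T \<and> G \<subseteq> Pow S \<and> \<Union>G = S"

definition gr_lower :: "'a set set \<Rightarrow> 'a set \<Rightarrow> 'a set" where
  "gr_lower G X = \<Union>{A \<in> G. A \<subseteq> X}"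

definition gr_upper :: "'a set set \<Rightarrow> 'a set \<Rightarrow> 'a set" where
  "gr_upper G X = \<Union>{A \<in> G. A \<inter> X \<noteq> {}}"

definition gr_bitten_upper :: "'a set \<Rightarrow> 'a set set \<Rightarrow> 'a set \<Rightarrow> 'a set" where
  "gr_bitten_upper S G X = gr_upper G X - gr_lower G (S - X)"

text \<open>
  An AUAI approximation system is a set \<open>S\<close> with a family \<open>K 1, \<dots>, K n\<close> of subsets of \<open>S\<close>,
  possibly with repetitions; values of \<open>K\<close> at other indices are irrelevant.
  \<open>auai_ext S n K\<close> is the family with the conventional members at indices \<open>0\<close> and \<open>n + 1\<close>.
\<close>

definition auai_approximation_system :: "'a set \<Rightarrow> nat \<Rightarrow> (nat \<Rightarrow> 'a set) \<Rightarrow> bool" where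
  "auai_approximation_system S n K \<longleftrightarrow> (\<forall>i\<in>{1..n}. K i \<subseteq> S)"

definition auai_ext :: "'a set \<Rightarrow> nat \<Rightarrow> (nat \<Rightarrow> 'a set) \<Rightarrow> nat \<Rightarrow> 'a set" where
  "auai_ext S n K i = (if i = 0 then {} else if i = n + 1 then S else K i)"

definition auai_l1 :: "'a set \<Rightarrow> nat \<Rightarrow> (nat \<Rightarrow> 'a set) \<Rightarrow> 'a set \<Rightarrow> 'a set" where
  "auai_l1 S n K X = \<Union>{auai_ext S n K i | i. auai_ext S n K i \<subseteq> X \<and> i \<in> {0..n}}"

text \<open>
  For \<open>X \<subseteq> S\<close> the families intersected below are nonempty: they contain \<open>S\<close>, from
  \<open>I = {n + 1}\<close> and \<open>i = 0\<close> respectively.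
\<close>

definition auai_u1 :: "'a set \<Rightarrow> nat \<Rightarrow> (nat \<Rightarrow> 'a set) \<Rightarrow> 'a set \<Rightarrow> 'a set" where
  "auai_u1 S n K X =
     \<Inter>{(\<Union>i\<in>I. auai_ext S n K i) | I. X \<subseteq> (\<Union>i\<in>I. auai_ext S n K i) \<and> I \<subseteq> {1..n + 1}}"

definition auai_u2 :: "'a set \<Rightarrow> nat \<Rightarrow> (nat \<Rightarrow> 'a set) \<Rightarrow> 'a set \<Rightarrow> 'a set" where
  "auai_u2 S n K X =
     \<Inter>{S - auai_ext S n K i | i. X \<subseteq> S - auai_ext S n K i \<and> i \<in> {0..n}}"

lemma auai_enumeration_exists:
  assumes "bitten_approximation_system S T G" and "finite G"
  shows "\<exists>n K. auai_approximation_system S n K \<and> K ` {1..n} = G"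
proof -
  obtain K where "bij_betw K {1..card G} G"
    using ex_bij_betw_nat_finite_1[OF assms(2)] by blast
  then have "K ` {1..card G} = G"
    by (simp add: bij_betw_def)
  moreover from this have "auai_approximation_system S (card G) K"
    using assms(1)
    unfolding auai_approximation_system_def bitten_approximation_system_def by blast
  ultimately show ?thesis by blast
qed

end

theory Submission
  imports Defs
begin

text \<open>
  The AUAI operators look at \<open>K\<close> only through the sets that it enumerates: indices \<open>0\<close> to \<open>n\<close>
  give the granules together with the empty set (\<open>auai_ext_image\<close>). For the lower approximation
  the empty set contributes nothing to a union, so \<open>X\<^sup>l\<^sup>1\<close> is the granular lower
  approximation. For \<open>X\<^sup>u\<^sup>1\<close>, the granules that meet \<open>X\<close> cover \<open>X\<close>, because the granules cover
  \<open>S\<close>; so their union, which is the granular upper approximation, is one of the sets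
  intersected.

  The third claim is De Morgan duality. A granule is avoided by \<open>X\<close> exactly when it lies in
  \<open>S - X\<close>, so intersecting the complements of the avoided granules removes from \<open>S\<close> the lower
  approximation of \<open>S - X\<close> (\<open>auai_u2_eq_complement_lower\<close>). The bitten upper approximation
  removes the same set from the granular upper approximation, which is a subset of \<open>S\<close>.
\<close>

lemma auai_ext_eq_family: "i \<in> {1..n} \<Longrightarrow> auai_ext S n K i = K i"
  by (simp add: auai_ext_def)

lemma auai_ext_image: "auai_ext S n K ` {0..n} = insert {} (K ` {1..n})"
proof -
  have "{0..n} = insert 0 {1..n}" by auto
  moreover have "auai_ext S n K ` {1..n} = K ` {1..n}"
    by (rule image_cong) (simp_all add: auai_ext_eq_family)
  moreover have "auai_ext S n K 0 = {}" by (simp add: auai_ext_def)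
  ultimately show ?thesis by simp
qed

lemma auai_l1_eq_gr_lower: "auai_l1 S n K X = gr_lower (K ` {1..n}) X"
proof -
  have "auai_l1 S n K X = \<Union>{A \<in> auai_ext S n K ` {0..n}. A \<subseteq> X}"
    unfolding auai_l1_def by blast
  also have "\<dots> = gr_lower (K ` {1..n}) X"
    unfolding auai_ext_image gr_lower_def by blast
  finally show ?thesis .
qed

text \<open>
  The cover that witnesses the inclusion consists of the granules meeting \<open>X\<close>; it is a cover of
  \<open>X\<close> since every point of \<open>X\<close> lies in some granule, which then meets \<open>X\<close> at that point.
\<close>

lemma auai_u1_subset_gr_upper:
  assumes "X \<subseteq> \<Union>(K ` {1..n})"
  shows "auai_u1 S n K X \<subseteq> gr_upper (K ` {1..n}) X"
proof -
  define I where "I = {i \<in> {1..n}. K i \<inter> X \<noteq> {}}"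
  have "(\<Union>i\<in>I. auai_ext S n K i) = (\<Union>i\<in>I. K i)"
    by (rule SUP_cong) (simp_all add: I_def auai_ext_eq_family)
  also have "\<dots> = gr_upper (K ` {1..n}) X"
    unfolding gr_upper_def I_def by blast
  finally have union_I: "(\<Union>i\<in>I. auai_ext S n K i) = gr_upper (K ` {1..n}) X" .
  have "X \<subseteq> gr_upper (K ` {1..n}) X"
    using assms unfolding gr_upper_def by blast
  moreover have "I \<subseteq> {1..n + 1}" by (auto simp: I_def)
  ultimately show ?thesis
    unfolding auai_u1_def using union_I by (intro Inter_lower) blast
qed

text \<open>
  De Morgan duality. The index \<open>0\<close> matters here: its complement \<open>S\<close> keeps the intersection
  inside \<open>S\<close> even if \<open>X\<close> meets every granule.
\<close>

lemma auai_u2_eq_complement_lower: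
  assumes "X \<subseteq> S" and "\<And>i. i \<in> {1..n} \<Longrightarrow> K i \<subseteq> S"
  shows "auai_u2 S n K X = S - gr_lower (K ` {1..n}) (S - X)"
proof -
  have "auai_u2 S n K X = \<Inter>{S - A | A. A \<in> auai_ext S n K ` {0..n} \<and> X \<subseteq> S - A}"
    unfolding auai_u2_def by (rule arg_cong[where f = Inter]) blast
  also have "\<dots> = \<Inter>{S - A | A. A \<in> insert {} (K ` {1..n}) \<and> A \<subseteq> S - X}"
  proof -
    have "X \<subseteq> S - A \<longleftrightarrow> A \<subseteq> S - X" if "A \<in> insert {} (K ` {1..n})" for A
      using that assms by blast
    then show ?thesis
      unfolding auai_ext_image by (intro arg_cong[where f = Inter]) blast
  qed
  also have "\<dots> = S - \<Union>{A \<in> insert {} (K ` {1..n}). A \<subseteq> S - X}"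
    by blast
  also have "\<dots> = S - gr_lower (K ` {1..n}) (S - X)"
    unfolding gr_lower_def by blast
  finally show ?thesis .
qed

theorem theorem5p1:
  fixes S :: "'a set" and T :: "('a \<times> 'a) set" and G :: "'a set set"
    and n :: nat and K :: "nat \<Rightarrow> 'a set"
  assumes "bitten_approximation_system S T G"
    and "finite G"
    and "auai_approximation_system S n K"
    and "K ` {1..n} = G"
  shows "(\<forall>X\<in>Pow S. auai_l1 S n K X = gr_lower G X) \<and>
         (\<forall>X\<in>Pow S. auai_u1 S n K X \<subseteq> gr_upper G X) \<and>
         (\<forall>X\<in>Pow S. gr_bitten_upper S G X = gr_upper G X \<inter> auai_u2 S n K X)"
proof (intro conjI ballI)
  have cover: "\<Union>G = S"
    using assms(1) by (simp add: bitten_approximation_system_def)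
  fix X assume "X \<in> Pow S"
  then have X: "X \<subseteq> S" by simp
  show "auai_l1 S n K X = gr_lower G X"
    using auai_l1_eq_gr_lower[of S n K X] assms(4) by simp
  show "auai_u1 S n K X \<subseteq> gr_upper G X"
    using auai_u1_subset_gr_upper[of X K n S] X cover assms(4) by simp
  have "K i \<subseteq> S" if "i \<in> {1..n}" for i
    using assms(3) that by (simp add: auai_approximation_system_def)
  then have "auai_u2 S n K X = S - gr_lower G (S - X)"
    using auai_u2_eq_complement_lower[OF X, of n K] assms(4) by simp
  moreover have "gr_upper G X \<subseteq> S"
    using cover unfolding gr_upper_def by blast
  ultimately show "gr_bitten_upper S G X = gr_upper G X \<inter> auai_u2 S n K X"
    unfolding gr_bitten_upper_def by blast
qed

end
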